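(* For all $a,b\in\mathbb{N}$, the zero forcing number of the Hopi rectangle graph $HD(a,b)$ is $Z(HD(a,b))=a+b$. In particular, the maximum nullity and the zero forcing number are equal for this family of graphs: $M(HD(a,b))=Z(HD(a,b))$.
   Context: All graphs are finite, simple and undirected; $\mathbb{N}$ denotes the positive integers. Hopi rectangle graph: for $a,b\in\mathbb{N}$, view the vertices of the grid graph $P_{a+b}\square P_{a+b}$ as the integer pairs $(i,j)$ with $0\le i,j\le a+b-1$, two pairs being adjacent iff they differ by $\pm(1,0)$ or $\pm(0,1)$. The Hopi rectangle graph $HD(a,b)$ of order $(a,b)$ is the subgraph of $P_{a+b}\square P_{a+b}$ induced by the vertex set $$\{(i,j): a-1\le i+j\le 2b+a-1 \text{ and } |i-j|\le a\}.$$ Zero forcing: given a coloring of $V(G)$ in blue and white, a blue vertex $u$ having exactly one white neighbor $v$ may force $v$ to become blue. A set $B\subseteq V(G)$ is a zero forcing set if, starting with exactly the vertices of $B$ blue and repeatedly applying this rule, all vertices of $G$ eventually become blue. The zero forcing number $Z(G)$ is the minimum cardinality of a zero forcing set. Maximum nullity: for a graph $G$ on $n$ vertices (labelled $1,\dots,n$), $\mathcal{S}(G)$ is the set of real symmetric $n\times n$ matrices $A=(a_{i,j})$ such that for all $i\neq j$, $a_{i,j}\neq0$ iff $ij\in E(G)$ (diagonal entries are unrestricted). $M(G)=\max\{\operatorname{null}(A):A\in\mathcal{S}(G)\}$. *)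

theory Defs
  imports "Graph_Theory.Graph_Theory" "Jordan_Normal_Form.Matrix_Kernel"
begin

text \<open>
  A finite simple undirected graph is an instance of the locale \<^locale>\<open>graph\<close>: a finite
  digraph without loops and parallel arcs whose adjacency relation is symmetric.
\<close>

text \<open>The Cartesian product of two paths on \<open>n\<close> vertices each.\<close>

definition grid_graph :: "nat \<Rightarrow> (int \<times> int) pair_pre_digraph" where
  "grid_graph n =
    (let V = {0..int n - 1} \<times> {0..int n - 1} in
      \<lparr> pverts = V,
        parcs = {(u, v). u \<in> V \<and> v \<in> V \<and>
          (fst v - fst u, snd v - snd u) \<in> {(1, 0), (-1, 0), (0, 1), (0, -1)}} \<rparr>)"

definition hopi_rectangle ::
  "nat \<Rightarrow> nat \<Rightarrow> (int \<times> int, (int \<times> int) \<times> (int \<times> int)) pre_digraph" where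
  "hopi_rectangle a b =
    with_proj (grid_graph (a + b)) \<restriction>
      {(i, j). (i, j) \<in> pverts (grid_graph (a + b)) \<and>
        int a - 1 \<le> i + j \<and> i + j \<le> 2 * int b + int a - 1 \<and> \<bar>i - j\<bar> \<le> int a}"

text \<open>\<open>B\<close> is the set of blue vertices before, \<open>B'\<close> after a single force.\<close>

definition force_step :: "('v, 'e) pre_digraph \<Rightarrow> 'v set \<Rightarrow> 'v set \<Rightarrow> bool" where
  "force_step G B B' \<longleftrightarrow>
    (\<exists>u\<in>B. \<exists>v. {w. u \<rightarrow>\<^bsub>G\<^esub> w \<and> w \<notin> B} = {v} \<and> B' = insert v B)"

definition zero_forcing_set :: "('v, 'e) pre_digraph \<Rightarrow> 'v set \<Rightarrow> bool" where
  "zero_forcing_set G B \<longleftrightarrow> B \<subseteq> verts G \<and> (force_step G)\<^sup>*\<^sup>* B (verts G)"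

definition zero_forcing_number :: "('v, 'e) pre_digraph \<Rightarrow> nat" where
  "zero_forcing_number G = Min {card B | B. zero_forcing_set G B}"

text \<open>
  Rows and columns are indexed by \<open>0, \<dots>, n - 1\<close>, and \<open>l i\<close> is the vertex with label \<open>i\<close>.
  All labellings are admitted; relabelling permutes rows and columns simultaneously, which does
  not change the nullity.
\<close>

definition graph_matrices :: "('v, 'e) pre_digraph \<Rightarrow> real mat set" where
  "graph_matrices G =
    {A \<in> carrier_mat (card (verts G)) (card (verts G)).
      transpose_mat A = A \<and>
      (\<exists>l. bij_betw l {..<card (verts G)} (verts G) \<and>
        (\<forall>i < card (verts G). \<forall>j < card (verts G).
          i \<noteq> j \<longrightarrow> (A $$ (i, j) \<noteq> 0 \<longleftrightarrow> l i \<rightarrow>\<^bsub>G\<^esub> l j)))}"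

definition max_nullity :: "('v, 'e) pre_digraph \<Rightarrow> nat" where
  "max_nullity G = Max {kernel_dim A | A. A \<in> graph_matrices G}"

lemma pair_graph_grid_graph: "pair_graph (grid_graph n)"
proof
  show "finite (pverts (grid_graph n))"
    by (simp add: grid_graph_def Let_def)
  have "parcs (grid_graph n) \<subseteq> pverts (grid_graph n) \<times> pverts (grid_graph n)"
    by (auto simp: grid_graph_def Let_def)
  then show "finite (parcs (grid_graph n))"
    by (rule finite_subset) (simp add: grid_graph_def Let_def)
qed (auto simp: grid_graph_def Let_def symmetric_def sym_def)

lemma graph_hopi_rectangle: "graph (hopi_rectangle a b)"
proof -
  interpret G: graph "with_proj (grid_graph (a + b))"
    by (rule pair_graph.pair_graphD_graph[OF pair_graph_grid_graph])
  let ?H = "hopi_rectangle a b"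
  have ind: "induced_subgraph ?H (with_proj (grid_graph (a + b)))"
    unfolding hopi_rectangle_def by (rule G.induced_induce) auto
  have "digraph ?H"
    using ind by (rule G.digraph_subgraph[OF induced_imp_subgraph])
  then show ?thesis
    by (rule digraph.graphI) (rule induced_graph_imp_symmetric[OF G.sym_arcs ind])
qed

lemma verts_hopi_rectangle:
  "verts (hopi_rectangle a b) =
    {(i, j). 0 \<le> i \<and> i \<le> int a + int b - 1 \<and> 0 \<le> j \<and> j \<le> int a + int b - 1 \<and>
      int a - 1 \<le> i + j \<and> i + j \<le> 2 * int b + int a - 1 \<and> \<bar>i - j\<bar> \<le> int a}"
  by (auto simp: hopi_rectangle_def grid_graph_def Let_def)

lemma adj_hopi_rectangle:
  "u \<rightarrow>\<^bsub>hopi_rectangle a b\<^esub> v \<longleftrightarrow>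
    u \<in> verts (hopi_rectangle a b) \<and> v \<in> verts (hopi_rectangle a b) \<and>
    \<bar>fst u - fst v\<bar> + \<bar>snd u - snd v\<bar> = 1"
  by (cases u; cases v)
    (auto simp: hopi_rectangle_def grid_graph_def Let_def arcs_ends_def arc_to_ends_def image_iff)

lemma zero_forcing_set_verts: "zero_forcing_set G (verts G)"
  by (simp add: zero_forcing_set_def)

lemma finite_zero_forcing_cards:
  assumes "finite (verts G)"
  shows "finite {card B | B. zero_forcing_set G B}"
proof -
  have "{card B | B. zero_forcing_set G B} \<subseteq> card ` Pow (verts G)"
    by (auto simp: zero_forcing_set_def)
  then show ?thesis
    using assms by (meson finite_Pow_iff finite_imageI finite_subset)
qed

lemma graph_matrices_nonempty:
  fixes G :: "('v, 'e) pre_digraph"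
  assumes "graph G"
  shows "graph_matrices G \<noteq> {}"
proof -
  interpret graph G by fact
  let ?n = "card (verts G)"
  obtain l where l: "bij_betw l {..<?n} (verts G)"
    using ex_bij_betw_nat_finite[OF finite_verts] by (auto simp: atLeast0LessThan)
  let ?A = "mat ?n ?n (\<lambda>(i, j). if l i \<rightarrow>\<^bsub>G\<^esub> l j then 1 else 0 :: real)"
  have "transpose_mat ?A = ?A"
    by (rule eq_matI) (auto intro: arcs_ends_symmetric[OF sym_arcs])
  with l have "?A \<in> graph_matrices G"
    by (auto simp: graph_matrices_def)
  then show ?thesis by blast
qed

lemma finite_nullities: "finite {kernel_dim A | A. A \<in> graph_matrices G}"
proof (rule finite_subset)
  show "{kernel_dim A | A. A \<in> graph_matrices G} \<subseteq> {..card (verts G)}"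
    by (auto simp: graph_matrices_def kernel_dim_code)
qed simp

end

theory Submission
  imports Defs
begin

text \<open>The nullity of a matrix of a graph is at most the size of any zero forcing set. The
  antidiagonal \<open>i + j = a - 1\<close> together with the vertices \<open>(a + q, q)\<close> is a zero forcing set of
  \<open>a + b\<close> vertices. Conversely, the adjacency matrix has nullity at least \<open>a + b\<close>: between the two
  colour classes of the grid it is the Kronecker product of an \<open>a \<times> (a + 1)\<close> and a
  \<open>(b + 1) \<times> b\<close> incidence matrix of a path, which yields alternating null vectors supported
  on single diagonals and antidiagonals.\<close>

section \<open>Linear algebra: bounding a kernel dimension from above and below\<close>

text \<open>Padding the \<open>k\<close> equations with zero rows to a square matrix of size
  \<open>m\<close> leaves row \<open>k\<close> equal to zero, so the determinant vanishes and a
  nonzero null vector exists.\<close>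

lemma underdetermined_system:
  fixes c :: "nat \<Rightarrow> nat \<Rightarrow> 'a :: field"
  assumes "k < m"
  obtains v where "v \<in> carrier_vec m" "v \<noteq> 0\<^sub>v m"
    "\<And>i. i < k \<Longrightarrow> (\<Sum>j<m. c i j * v $ j) = 0"
proof -
  let ?M = "mat m m (\<lambda>(i, j). if i < k then c i j else 0)"
  have "?M = mat\<^sub>r m m (\<lambda>i. if i = k then 0\<^sub>v m else row ?M i)"
    by (rule eq_matI) auto
  also have "det \<dots> = 0"
    using assms by (intro det_row_0) auto
  finally obtain v where v: "v \<in> carrier_vec m" "v \<noteq> 0\<^sub>v m" and Mv: "?M *\<^sub>v v = 0\<^sub>v m"
    using det_0_iff_vec_prod_zero_field[of ?M m] by auto
  have "(\<Sum>j<m. c i j * v $ j) = 0" if "i < k" for i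
  proof -
    have "(?M *\<^sub>v v) $ i = (\<Sum>j<m. c i j * v $ j)"
      using that assms v by (simp add: scalar_prod_def atLeast0LessThan)
    then show ?thesis
      using that assms by (simp add: Mv)
  qed
  with v show thesis by (rule that)
qed

context kernel
begin

lemma finite_basis:
  obtains \<beta> where "finite \<beta>" "basis \<beta>" "card \<beta> = dim"
  using kernel_basis_exists[OF A] Ker.dim_basis by metis

lemma fin_dim: "Ker.fin_dim"
  using finite_basis unfolding Ker.fin_dim_def Ker.basis_def by metis

text \<open>A kernel basis with more than \<open>card S\<close> elements would have a nontrivial
  linear combination vanishing at every position in \<open>S\<close>, since that imposes only
  \<open>card S\<close> conditions on its coefficients. By \<open>inj\<close> this combination is
  zero, contradicting independence.\<close>

lemma kernel_dim_le:
  assumes S: "finite S" "S \<subseteq> {..<nc}"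
    and inj: "\<And>v. v \<in> mat_kernel A \<Longrightarrow> (\<And>i. i \<in> S \<Longrightarrow> v $ i = 0) \<Longrightarrow> v = 0\<^sub>v nc"
  shows "kernel_dim A \<le> card S"
proof (rule ccontr)
  assume *: "\<not> kernel_dim A \<le> card S"
  obtain \<beta> where \<beta>: "finite \<beta>" "basis \<beta>" "card \<beta> = dim"
    by (rule finite_basis)
  obtain e where e: "bij_betw e {..<card \<beta>} \<beta>"
    using ex_bij_betw_nat_finite[OF \<beta>(1)] by (auto simp: atLeast0LessThan)
  obtain s where s: "bij_betw s {..<card S} S"
    using ex_bij_betw_nat_finite[OF S(1)] by (auto simp: atLeast0LessThan)
  have "card S < card \<beta>"
    using * \<beta>(3) by simp
  then obtain v where v: "v \<in> carrier_vec (card \<beta>)" "v \<noteq> 0\<^sub>v (card \<beta>)"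
    "\<And>i. i < card S \<Longrightarrow> (\<Sum>j<card \<beta>. e j $ s i * v $ j) = 0"
    by (rule underdetermined_system[where c = "\<lambda>i j. e j $ s i"]) blast
  \<comment> \<open>\<open>lincomb\<close> expects coefficients indexed by the basis vectors
    themselves, so the solution \<open>v\<close> is transported along the enumeration
    \<open>e\<close>.\<close>
  define c where "c x = v $ inv_into {..<card \<beta>} e x" for x
  have c: "c (e j) = v $ j" if "j < card \<beta>" for j
    using that e by (simp add: c_def bij_betw_inv_into_left)
  have sub: "\<beta> \<subseteq> mat_kernel A" and indpt: "lin_indpt \<beta>"
    using \<beta>(2) by (auto simp: Ker.basis_def)
  let ?w = "lincomb c \<beta>"
  have w: "?w $ i = (\<Sum>j<card \<beta>. e j $ i * v $ j)" if "i < nc" for i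
    unfolding lincomb_index[OF that sub] sum.reindex_bij_betw[OF e, symmetric]
    by (simp add: c mult.commute)
  have "?w $ i = 0" if "i \<in> S" for i
  proof -
    from that s obtain k where "k < card S" "i = s k"
      by (auto simp: bij_betw_def)
    with v(3) w[of i] S(2) that show ?thesis by auto
  qed
  moreover have "?w \<in> mat_kernel A"
    by (rule Ker.lincomb_closed[OF sub]) auto
  ultimately have w0: "?w = 0\<^sub>v nc"
    by (intro inj)
  have "c x = 0" if "x \<in> \<beta>" for x
    using indpt \<beta>(1) w0 that unfolding Ker.lin_dep_def by auto
  then have "v $ j = 0" if "j < card \<beta>" for j
    using that c e by (metis bij_betwE lessThan_iff)
  with v(1,2) show False by auto
qed

text \<open>Each vector of \<open>S\<close> owns a coordinate at which all the others vanish.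
  Reading a vanishing combination at that coordinate isolates the coefficient of its owner, so
  \<open>S\<close> is independent.\<close>

lemma card_le_kernel_dim:
  assumes "finite S" and sub: "S \<subseteq> mat_kernel A"
    and peak: "\<And>v. v \<in> S \<Longrightarrow> \<exists>i<nc. v $ i \<noteq> 0 \<and> (\<forall>w\<in>S - {v}. w $ i = 0)"
  shows "card S \<le> kernel_dim A"
proof -
  have "lin_indpt S"
  proof (rule Ker.finite_lin_indpt2[OF \<open>finite S\<close> sub], intro ballI)
    fix c v assume 0: "lincomb c S = 0\<^sub>v nc" and "v \<in> S"
    from peak[OF \<open>v \<in> S\<close>] obtain i
      where i: "i < nc" "v $ i \<noteq> 0" "\<And>w. w \<in> S - {v} \<Longrightarrow> w $ i = 0" by auto
    have "0 = (\<Sum>w\<in>S. c w * w $ i)"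
      using lincomb_index[OF i(1) sub, of c] 0 i(1) by simp
    also have "\<dots> = c v * v $ i"
      using \<open>finite S\<close> \<open>v \<in> S\<close> i(3) by (simp add: sum.remove)
    finally show "c v = 0"
      using i(2) by simp
  qed
  then show ?thesis
    using Ker.li_le_dim(2)[OF fin_dim sub] by simp
qed

end

section \<open>Nullity and zero forcing in an arbitrary graph\<close>

lemma kernel_dim_le_max_nullity:
  assumes "A \<in> graph_matrices G"
  shows "kernel_dim A \<le> max_nullity G"
  unfolding max_nullity_def using finite_nullities assms by (intro Max_ge) auto

text \<open>If \<open>u\<close> forces \<open>v\<close>, then row \<open>u\<close> of a matrix of the graph is an equation whose only surviving
  unknown is the entry at \<open>v\<close>. So a kernel vector that vanishes on a zero forcing set is \<open>0\<close>.\<close>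

lemma kernel_dim_le_card_zero_forcing_set:
  assumes "graph G" "A \<in> graph_matrices G" "zero_forcing_set G B"
  shows "kernel_dim A \<le> card B"
proof -
  interpret graph G by fact
  let ?n = "card (verts G)"
  from assms(2) obtain l where A: "A \<in> carrier_mat ?n ?n"
    and l: "bij_betw l {..<?n} (verts G)"
    and adj: "\<And>i j. i < ?n \<Longrightarrow> j < ?n \<Longrightarrow> i \<noteq> j \<Longrightarrow> A $$ (i, j) \<noteq> 0 \<longleftrightarrow> l i \<rightarrow>\<^bsub>G\<^esub> l j"
    by (auto simp: graph_matrices_def)
  have B: "B \<subseteq> verts G" and forces: "(force_step G)\<^sup>*\<^sup>* B (verts G)"
    using assms(3) by (auto simp: zero_forcing_set_def)
  interpret K: kernel ?n ?n A
    by unfold_locales (rule A)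
  define S where "S = {i. i < ?n \<and> l i \<in> B}"
  have "bij_betw l S B"
    using l B unfolding S_def bij_betw_def by (auto intro: inj_on_subset)
  then have card_S: "card S = card B"
    by (rule bij_betw_same_card)
  have "kernel_dim A \<le> card S"
  proof (rule K.kernel_dim_le)
    fix v assume v: "v \<in> mat_kernel A" and vS: "\<And>i. i \<in> S \<Longrightarrow> v $ i = 0"
    have Av: "A *\<^sub>v v = 0\<^sub>v ?n" and vn: "v \<in> carrier_vec ?n"
      using v by (auto dest: mat_kernelD[OF A])
    have "C \<subseteq> verts G \<and> (\<forall>i<?n. l i \<in> C \<longrightarrow> v $ i = 0)"
      if "(force_step G)\<^sup>*\<^sup>* B C" for C
      using that
    proof (induction rule: rtranclp_induct)
      case base
      then show ?case using B vS by (auto simp: S_def)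
    next
      case (step C D)
      from step.hyps(2) obtain x y where x: "x \<in> C"
        and xy: "{w. x \<rightarrow>\<^bsub>G\<^esub> w \<and> w \<notin> C} = {y}" and D: "D = insert y C"
        by (auto simp: force_step_def)
      have "x \<rightarrow>\<^bsub>G\<^esub> y" "y \<notin> C"
        using xy by auto
      then have "x \<in> l ` {..<?n}" "y \<in> l ` {..<?n}"
        using l by (auto simp: bij_betw_def dest: adj_in_verts)
      then obtain i j where i: "i < ?n" "l i = x" and j: "j < ?n" "l j = y"
        by auto
      have l_eq: "k = j" if "k < ?n" "l k = y" for k
        using that j l by (auto simp: bij_betw_def inj_on_def)
      \<comment> \<open>Diagonal entries of \<open>A\<close> are unrestricted, but the term
        \<open>k = i\<close> causes no trouble: \<open>x\<close> is blue, so it falls under the case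
        where \<open>v $ k\<close> is already 0.\<close>
      have other: "A $$ (i, k) * v $ k = 0" if k: "k < ?n" "k \<noteq> j" for k
      proof (cases "l k \<in> C")
        case True
        with step.IH k show ?thesis by simp
      next
        case False
        have "l k \<noteq> y"
          using k l_eq by blast
        with False xy i have "\<not> l i \<rightarrow>\<^bsub>G\<^esub> l k" "i \<noteq> k"
          using x by auto
        with adj[OF i(1) k(1)] show ?thesis by simp
      qed
      have "0 = (A *\<^sub>v v) $ i"
        using i by (simp add: Av)
      also have "\<dots> = (\<Sum>k<?n. A $$ (i, k) * v $ k)"
        using A vn i by (simp add: scalar_prod_def atLeast0LessThan)
      also have "\<dots> = A $$ (i, j) * v $ j"
        using j other by (subst sum.remove[of _ j]) (auto intro!: sum.neutral simp del: mult_eq_0_iff)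
      finally have "v $ j = 0"
        using adj[OF i(1) j(1)] \<open>x \<rightarrow>\<^bsub>G\<^esub> y\<close> \<open>y \<notin> C\<close> x i j by auto
      then show ?case
        using step.IH l_eq D adj_in_verts(2)[OF \<open>x \<rightarrow>\<^bsub>G\<^esub> y\<close>] by auto
    qed
    from this[OF forces] show "v = 0\<^sub>v ?n"
      using l vn by (intro eq_vecI) (auto dest: bij_betwE)
  qed (auto simp: S_def)
  then show ?thesis by (simp add: card_S)
qed

text \<open>Both extrema range over finite nonempty sets and are attained, so the bound for a single
  matrix and a single forcing set carries over to them.\<close>

lemma max_nullity_le_zero_forcing_number:
  assumes "graph G"
  shows "max_nullity G \<le> zero_forcing_number G"
proof -
  have fin: "finite (verts G)"
    using assms by (simp add: graph_def digraph_def fin_digraph_def fin_digraph_axioms_def)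
  have "zero_forcing_number G \<in> {card B | B. zero_forcing_set G B}"
    unfolding zero_forcing_number_def
    using finite_zero_forcing_cards[OF fin] zero_forcing_set_verts by (intro Min_in) auto
  then obtain B where B: "zero_forcing_set G B" "zero_forcing_number G = card B"
    by auto
  have "max_nullity G \<in> {kernel_dim A | A. A \<in> graph_matrices G}"
    unfolding max_nullity_def
    using finite_nullities graph_matrices_nonempty[OF assms] by (intro Max_in) auto
  with B kernel_dim_le_card_zero_forcing_set[OF assms _ B(1)] show ?thesis
    by auto
qed

lemma zero_forcing_number_le:
  assumes "finite (verts G)" "zero_forcing_set G B"
  shows "zero_forcing_number G \<le> card B"
  unfolding zero_forcing_number_def
  using finite_zero_forcing_cards[OF assms(1)] assms(2) by (intro Min_le) auto

text \<open>Induction on the number of white vertices. As \<open>progress\<close> covers every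
  intermediate blue set, no explicit order of forces has to be given.\<close>

lemma zero_forcing_setI:
  assumes fin: "finite (verts G)" and B: "B \<subseteq> verts G"
    and progress: "\<And>C. B \<subseteq> C \<Longrightarrow> C \<subset> verts G \<Longrightarrow>
      \<exists>x\<in>C. \<exists>y\<in>verts G. {w. x \<rightarrow>\<^bsub>G\<^esub> w \<and> w \<notin> C} = {y}"
  shows "zero_forcing_set G B"
proof -
  have "(force_step G)\<^sup>*\<^sup>* C (verts G)" if "B \<subseteq> C" "C \<subseteq> verts G" for C
    using that
  proof (induction "card (verts G - C)" arbitrary: C rule: less_induct)
    case less
    show ?case
    proof (cases "C = verts G")
      case False
      with less.prems progress[of C] obtain x y
        where xy: "x \<in> C" "y \<in> verts G" "{w. x \<rightarrow>\<^bsub>G\<^esub> w \<and> w \<notin> C} = {y}" by blast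
      then have "y \<notin> C" by auto
      with xy fin have "card (verts G - insert y C) < card (verts G - C)"
        by (intro psubset_card_mono) auto
      then have "(force_step G)\<^sup>*\<^sup>* (insert y C) (verts G)"
        using less xy(2) by blast
      moreover have "force_step G C (insert y C)"
        using xy unfolding force_step_def by blast
      ultimately show ?thesis
        by (rule converse_rtranclp_into_rtranclp[rotated])
    qed simp
  qed
  with B show ?thesis
    by (simp add: zero_forcing_set_def)
qed

text \<open>The witness is the adjacency matrix: \<open>ker\<close> says that each
  \<open>f r\<close> is a null vector of it, and \<open>diag\<close> with \<open>off_diag\<close>
  make \<open>r\<close> the coordinate owned by \<open>f r\<close>.\<close>

lemma card_le_max_nullity:
  fixes f :: "'v \<Rightarrow> 'v \<Rightarrow> real"
  assumes "graph G" and R: "R \<subseteq> verts G"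
    and ker: "\<And>r u. r \<in> R \<Longrightarrow> u \<in> verts G \<Longrightarrow> (\<Sum>w | u \<rightarrow>\<^bsub>G\<^esub> w. f r w) = 0"
    and diag: "\<And>r. r \<in> R \<Longrightarrow> f r r \<noteq> 0"
    and off_diag: "\<And>r r'. r \<in> R \<Longrightarrow> r' \<in> R \<Longrightarrow> r \<noteq> r' \<Longrightarrow> f r r' = 0"
  shows "card R \<le> max_nullity G"
proof -
  interpret graph G by fact
  let ?n = "card (verts G)"
  obtain l where l: "bij_betw l {..<?n} (verts G)"
    using ex_bij_betw_nat_finite[OF finite_verts] by (auto simp: atLeast0LessThan)
  define A where "A = mat ?n ?n (\<lambda>(i, j). if l i \<rightarrow>\<^bsub>G\<^esub> l j then 1 else 0 :: real)"
  have A: "A \<in> carrier_mat ?n ?n"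
    by (simp add: A_def)
  have "transpose_mat A = A"
    by (rule eq_matI) (auto simp: A_def intro: arcs_ends_symmetric[OF sym_arcs])
  with l A have A_in: "A \<in> graph_matrices G"
    by (auto simp: graph_matrices_def A_def)
  interpret K: kernel ?n ?n A
    by unfold_locales (rule A)
  define g where "g r = vec ?n (\<lambda>i. f r (l i))" for r
  have index: "\<exists>i<?n. l i = r" if "r \<in> R" for r
  proof -
    from that R l have "r \<in> l ` {..<?n}"
      by (auto simp: bij_betw_def)
    then show ?thesis by auto
  qed
  have g_index: "\<exists>i<?n. l i = r \<and> g r $ i \<noteq> 0 \<and> (\<forall>r'\<in>R - {r}. g r' $ i = 0)"
    if "r \<in> R" for r
    using index[OF that] that diag off_diag by (fastforce simp: g_def)
  \<comment> \<open>Without injectivity the image of \<open>R\<close> could have fewer elements than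
    \<open>R\<close>.\<close>
  have "inj_on g R"
  proof (rule inj_onI, rule ccontr)
    fix r r' assume "r \<in> R" "r' \<in> R" "g r = g r'" "r \<noteq> r'"
    with g_index[of r] show False by auto
  qed
  then have "card R = card (g ` R)"
    by (simp add: card_image)
  also have "\<dots> \<le> kernel_dim A"
  proof (rule K.card_le_kernel_dim)
    show "finite (g ` R)"
      using finite_subset[OF R finite_verts] by simp
    show "g ` R \<subseteq> mat_kernel A"
    proof safe
      fix r assume r: "r \<in> R"
      show "g r \<in> mat_kernel A"
      proof (rule mat_kernelI[OF A])
        show "A *\<^sub>v g r = 0\<^sub>v ?n"
        proof (rule eq_vecI)
          fix i assume "i < dim_vec (0\<^sub>v ?n)"
          then have i: "i < ?n" by simp
          have "(A *\<^sub>v g r) $ i = (\<Sum>j<?n. (if l i \<rightarrow>\<^bsub>G\<^esub> l j then f r (l j) else 0))"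
            using i by (auto simp: A_def g_def scalar_prod_def atLeast0LessThan intro: sum.cong)
          also have "\<dots> = (\<Sum>w\<in>verts G. if l i \<rightarrow>\<^bsub>G\<^esub> w then f r w else 0)"
            by (rule sum.reindex_bij_betw[OF l])
          also have "\<dots> = (\<Sum>w | l i \<rightarrow>\<^bsub>G\<^esub> w. f r w)"
            by (rule sum.mono_neutral_cong_right) auto
          also have "\<dots> = 0"
            using ker[OF r] i l by (auto dest: bij_betwE)
          finally show "(A *\<^sub>v g r) $ i = 0\<^sub>v ?n $ i"
            using i by simp
        qed (simp add: A_def)
      qed (simp add: g_def)
    qed
    show "\<exists>i<?n. v $ i \<noteq> 0 \<and> (\<forall>w\<in>g ` R - {v}. w $ i = 0)" if "v \<in> g ` R" for v
      using that g_index by blast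
  qed
  also have "\<dots> \<le> max_nullity G"
    using A_in by (rule kernel_dim_le_max_nullity)
  finally show ?thesis .
qed

section \<open>A zero forcing set of the Hopi rectangle\<close>

text \<open>These are two sides of the rectangle. The same set later labels the null vectors, so one
  count serves both bounds.\<close>

definition hopi_corner :: "nat \<Rightarrow> nat \<Rightarrow> (int \<times> int) set" where
  "hopi_corner a b =
    (\<lambda>p. (p, int a - 1 - p)) ` {0..<int a} \<union> (\<lambda>q. (int a + q, q)) ` {0..<int b}"

lemma card_hopi_corner: "card (hopi_corner a b) = a + b"
proof -
  let ?P = "(\<lambda>p. (p, int a - 1 - p)) ` {0..<int a}"
  let ?Q = "(\<lambda>q. (int a + q, q)) ` {0..<int b}"
  have "card (?P \<union> ?Q) = card ?P + card ?Q"
    by (rule card_Un_disjoint) (auto, presburger)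
  also have "card ?P = a"
    by (subst card_image) (auto simp: inj_on_def)
  also have "card ?Q = b"
    by (subst card_image) (auto simp: inj_on_def)
  finally show ?thesis
    by (simp add: hopi_corner_def)
qed

lemma hopi_corner_subset: "hopi_corner a b \<subseteq> verts (hopi_rectangle a b)"
  by (auto simp: hopi_corner_def verts_hopi_rectangle)

lemma finite_verts_hopi_rectangle: "finite (verts (hopi_rectangle a b))"
proof -
  interpret graph "hopi_rectangle a b" by (rule graph_hopi_rectangle)
  show ?thesis by simp
qed

text \<open>Used contrapositively: a vertex \<open>(i, j)\<close> outside the corner avoids both
  sides, which keeps \<open>(i, j - 1)\<close> inside the rectangle.\<close>

lemma hopi_corner_line:
  assumes "(i, j) \<in> verts (hopi_rectangle a b)" "i + j = int a - 1 \<or> i - j = int a"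
  shows "(i, j) \<in> hopi_corner a b"
proof -
  from assms(2) have "(i, j) = (i, int a - 1 - i) \<and> i \<in> {0..<int a} \<or>
      (i, j) = (int a + j, j) \<and> j \<in> {0..<int b}"
    using assms(1) by (auto simp: verts_hopi_rectangle)
  then show ?thesis
    unfolding hopi_corner_def by blast
qed

text \<open>The forces sweep the antidiagonals in order of increasing \<open>i + j\<close>, and each
  antidiagonal in order of increasing \<open>j\<close>. The first white vertex \<open>(i, j)\<close>
  in this order is forced by \<open>(i, j - 1)\<close>.\<close>

lemma zero_forcing_set_hopi_corner:
  "zero_forcing_set (hopi_rectangle a b) (hopi_corner a b)"
proof (rule zero_forcing_setI[OF finite_verts_hopi_rectangle hopi_corner_subset])
  let ?G = "hopi_rectangle a b"
  fix C assume C: "hopi_corner a b \<subseteq> C" "C \<subset> verts ?G"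
  \<comment> \<open>Lexicographic order by \<open>i + j\<close>, then \<open>j\<close>. The
    conversion to \<open>nat\<close> is faithful on vertices because their coordinates are
    nonnegative.\<close>
  let ?m = "[\<lambda>(i, j). nat (i + j), \<lambda>(i, j). nat j] :: (int \<times> int \<Rightarrow> nat) list"
  from C(2) obtain w0 where "w0 \<in> verts ?G - C"
    by blast
  then obtain w where w: "w \<in> verts ?G - C"
    and min: "\<And>u. (u, w) \<in> measures ?m \<Longrightarrow> u \<notin> verts ?G - C"
    using wfE_min[OF wf_measures] by metis
  obtain i j where ij: "w = (i, j)"
    by (cases w)
  have V: "(i, j) \<in> verts ?G" and "(i, j) \<notin> C"
    using w ij by auto
  with hopi_corner_line[OF V] C(1) have off: "i + j \<noteq> int a - 1" "i - j \<noteq> int a"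
    by auto
  have blue: "(i', j') \<in> C"
    if "(i', j') \<in> verts ?G" "i' + j' < i + j \<or> i' + j' = i + j \<and> j' < j" for i' j'
  proof -
    have "((i', j'), w) \<in> measures ?m"
      using that V unfolding ij by (auto simp: verts_hopi_rectangle)
    with min that(1) show ?thesis by blast
  qed
  have U: "(i, j - 1) \<in> verts ?G"
    using V off by (auto simp: verts_hopi_rectangle)
  \<comment> \<open>The other possible neighbours are \<open>(i - 1, j - 1)\<close> and
    \<open>(i, j - 2)\<close>, with smaller coordinate sum, and \<open>(i + 1, j - 1)\<close>, with
    equal sum and smaller second coordinate. By minimality all of these that are vertices are
    blue.\<close>
  have "{v. (i, j - 1) \<rightarrow>\<^bsub>?G\<^esub> v \<and> v \<notin> C} = {(i, j)}"
  proof (intro equalityI subsetI)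
    fix v assume "v \<in> {v. (i, j - 1) \<rightarrow>\<^bsub>?G\<^esub> v \<and> v \<notin> C}"
    moreover obtain i' j' where "v = (i', j')"
      by (cases v)
    ultimately have v: "(i', j') \<in> verts ?G" "(i', j') \<notin> C" "\<bar>i - i'\<bar> + \<bar>j - 1 - j'\<bar> = 1"
      "v = (i', j')"
      by (auto simp: adj_hopi_rectangle)
    with blue[OF v(1)] show "v \<in> {(i, j)}"
      by (auto simp: abs_if split: if_splits)
  qed (use U V \<open>(i, j) \<notin> C\<close> in \<open>auto simp: adj_hopi_rectangle\<close>)
  moreover have "(i, j - 1) \<in> C"
    using blue[OF U] by simp
  ultimately show "\<exists>x\<in>C. \<exists>y\<in>verts ?G. {v. x \<rightarrow>\<^bsub>?G\<^esub> v \<and> v \<notin> C} = {y}"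
    using V by blast
qed

section \<open>Null vectors of the adjacency matrix\<close>

text \<open>The null vector attached to a corner vertex lives on one antidiagonal or diagonal line of
  pairwise non-adjacent vertices, with alternating signs; each vertex has either no or exactly
  two (consecutive) neighbours on such a line.\<close>

definition hopi_null :: "nat \<Rightarrow> int \<times> int \<Rightarrow> int \<times> int \<Rightarrow> real" where
  "hopi_null a r v =
    (if (if fst r + snd r = int a - 1 then fst v - snd v = fst r - snd r
         else fst v + snd v = fst r + snd r)
     then if even (fst v) then 1 else -1 else 0)"

lemma sum_hopi_null:
  assumes r: "r \<in> hopi_corner a b" and u: "u \<in> verts (hopi_rectangle a b)"
  shows "(\<Sum>w | u \<rightarrow>\<^bsub>hopi_rectangle a b\<^esub> w. hopi_null a r w) = 0"
proof -
  let ?N = "{w. u \<rightarrow>\<^bsub>hopi_rectangle a b\<^esub> w}"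
  obtain i j where ij: "u = (i, j)"
    by (cases u)
  have N: "?N = {w \<in> verts (hopi_rectangle a b). \<bar>i - fst w\<bar> + \<bar>j - snd w\<bar> = 1}"
    using u by (auto simp: ij adj_hopi_rectangle)
  have mem: "(x, y) \<in> ?N \<longleftrightarrow>
      0 \<le> x \<and> x \<le> int a + int b - 1 \<and> 0 \<le> y \<and> y \<le> int a + int b - 1 \<and>
      int a - 1 \<le> x + y \<and> x + y \<le> 2 * int b + int a - 1 \<and> \<bar>x - y\<bar> \<le> int a \<and>
      \<bar>i - x\<bar> + \<bar>j - y\<bar> = 1" for x y
    unfolding N by (simp add: verts_hopi_rectangle)
  have bounds: "0 \<le> i" "i \<le> int a + int b - 1" "0 \<le> j" "j \<le> int a + int b - 1"
      "int a - 1 \<le> i + j" "i + j \<le> 2 * int b + int a - 1" "i - j \<le> int a" "- int a \<le> i - j"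
    using u unfolding ij by (auto simp: verts_hopi_rectangle)
  have fin: "finite ?N"
    unfolding N using finite_verts_hopi_rectangle by simp
  \<comment> \<open>In each use below, \<open>x\<close> and \<open>y\<close> are consecutive points
    of the line. Their first coordinates differ by 1, so their signs cancel.\<close>
  have pair: "(\<Sum>w\<in>?N. hopi_null a r w) = 0"
    if "x \<in> ?N" "y \<in> ?N" "x \<noteq> y" "hopi_null a r x + hopi_null a r y = 0"
      "\<And>w. w \<in> ?N \<Longrightarrow> w \<noteq> x \<Longrightarrow> w \<noteq> y \<Longrightarrow> hopi_null a r w = 0" for x y
  proof -
    have "(\<Sum>w\<in>?N. hopi_null a r w) = (\<Sum>w\<in>{x, y}. hopi_null a r w)"
      using that fin by (intro sum.mono_neutral_right) auto
    with that show ?thesis by simp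
  qed
  have nbr: "w \<in> {(i - 1, j), (i + 1, j), (i, j - 1), (i, j + 1)}" if "w \<in> ?N" for w
    using that unfolding N by (cases w) (auto simp: abs_if split: if_splits)
  from r consider p where "r = (p, int a - 1 - p)" "0 \<le> p" "p < int a"
    | q where "r = (int a + q, q)" "0 \<le> q" "q < int b"
    by (auto simp: hopi_corner_def)
  then show ?thesis
  proof cases
    case 1
    then have null: "hopi_null a r (x, y) =
        (if x - y = 2 * p + 1 - int a then if even x then 1 else -1 else 0)" for x y
      by (auto simp: hopi_null_def)
    \<comment> \<open>A step in the grid changes \<open>i - j\<close> by 1, so only vertices at
      distance 1 in this parameter have neighbours on the diagonal.\<close>
    consider "i - j = 2 * p + 2 - int a" | "i - j = 2 * p - int a"
      | "i - j \<noteq> 2 * p + 2 - int a" "i - j \<noteq> 2 * p - int a"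
      by blast
    then show ?thesis
    proof cases
      case A: 1
      \<comment> \<open>Parity: here \<open>i + j\<close> is congruent to \<open>a\<close> modulo 2,
        while the two sides that cut off the diagonal have \<open>i + j\<close> congruent to
        \<open>a - 1\<close>. Hence \<open>u\<close> lies on neither of them, and both neighbours on
        the diagonal belong to the rectangle.\<close>
      have off: "i + j \<noteq> int a - 1" "i + j \<noteq> 2 * int b + int a - 1"
        using A by presburger+
      show ?thesis
      proof (rule pair[of "(i - 1, j)" "(i, j + 1)"])
        show "hopi_null a r w = 0" if "w \<in> ?N" "w \<noteq> (i - 1, j)" "w \<noteq> (i, j + 1)" for w
          using nbr[OF that(1)] that(2,3) A by (auto simp: null)
        show "(i - 1, j) \<in> ?N" "(i, j + 1) \<in> ?N"
          using bounds off A 1(2,3) unfolding mem by auto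
      qed (use A in \<open>auto simp: null\<close>)
    next
      case A: 2
      have off: "i + j \<noteq> int a - 1" "i + j \<noteq> 2 * int b + int a - 1"
        using A by presburger+
      show ?thesis
      proof (rule pair[of "(i + 1, j)" "(i, j - 1)"])
        show "hopi_null a r w = 0" if "w \<in> ?N" "w \<noteq> (i + 1, j)" "w \<noteq> (i, j - 1)" for w
          using nbr[OF that(1)] that(2,3) A by (auto simp: null)
        show "(i + 1, j) \<in> ?N" "(i, j - 1) \<in> ?N"
          using bounds off A 1(2,3) unfolding mem by auto
      qed (use A in \<open>auto simp: null\<close>)
    next
      case 3
      then show ?thesis
        using nbr by (intro sum.neutral) (force simp: null)
    qed
  next
    case 2
    \<comment> \<open>The test in \<open>hopi_null\<close> picks the antidiagonal branch because
      \<open>a + 2 * q\<close> is never \<open>a - 1\<close>.\<close>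
    then have null: "hopi_null a r (x, y) =
        (if x + y = int a + 2 * q then if even x then 1 else -1 else 0)" for x y
      by (auto simp: hopi_null_def)
    consider "i + j = int a + 2 * q - 1" | "i + j = int a + 2 * q + 1"
      | "i + j \<noteq> int a + 2 * q - 1" "i + j \<noteq> int a + 2 * q + 1"
      by blast
    then show ?thesis
    proof cases
      case A: 1
      \<comment> \<open>The mirrored parity argument: \<open>i - j\<close> is congruent to
        \<open>a + 1\<close> modulo 2, so \<open>u\<close> avoids the sides where
        \<open>i - j\<close> is \<open>a\<close> or \<open>- a\<close>.\<close>
      have off: "i - j \<noteq> int a" "i - j \<noteq> - int a"
        using A by presburger+
      show ?thesis
      proof (rule pair[of "(i + 1, j)" "(i, j + 1)"])
        show "hopi_null a r w = 0" if "w \<in> ?N" "w \<noteq> (i + 1, j)" "w \<noteq> (i, j + 1)" for w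
          using nbr[OF that(1)] that(2,3) A by (auto simp: null)
        show "(i + 1, j) \<in> ?N" "(i, j + 1) \<in> ?N"
          using bounds off A 2(2,3) unfolding mem by auto
      qed (use A in \<open>auto simp: null\<close>)
    next
      case A: 2
      have off: "i - j \<noteq> int a" "i - j \<noteq> - int a"
        using A by presburger+
      show ?thesis
      proof (rule pair[of "(i - 1, j)" "(i, j - 1)"])
        show "hopi_null a r w = 0" if "w \<in> ?N" "w \<noteq> (i - 1, j)" "w \<noteq> (i, j - 1)" for w
          using nbr[OF that(1)] that(2,3) A by (auto simp: null)
        show "(i - 1, j) \<in> ?N" "(i, j - 1) \<in> ?N"
          using bounds off A 2(2,3) unfolding mem by auto
      qed (use A in \<open>auto simp: null\<close>)
    next
      case 3
      then show ?thesis
        using nbr by (intro sum.neutral) (force simp: null)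
    qed
  qed
qed

lemma hopi_null_diag: "hopi_null a r r \<noteq> 0"
  by (simp add: hopi_null_def)

text \<open>Each line meets the corner only in its own label. The diagonals through the points
  \<open>(p, a - 1 - p)\<close> have \<open>i - j\<close> at most \<open>a - 1\<close> and miss the
  side \<open>i - j = a\<close>. The antidiagonals through the points \<open>(a + q, q)\<close> have
  \<open>i + j\<close> at least \<open>a\<close> and miss the side
  \<open>i + j = a - 1\<close>.\<close>

lemma hopi_null_off_diag:
  assumes "r \<in> hopi_corner a b" "r' \<in> hopi_corner a b" "r \<noteq> r'"
  shows "hopi_null a r r' = 0"
  using assms by (auto simp: hopi_corner_def hopi_null_def)

theorem theorem17:
  fixes a b :: nat
  assumes "a \<ge> 1" and "b \<ge> 1"
  shows "zero_forcing_number (hopi_rectangle a b) = a + b \<and>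
    max_nullity (hopi_rectangle a b) = zero_forcing_number (hopi_rectangle a b)"
proof -
  let ?G = "hopi_rectangle a b"
  have "a + b \<le> max_nullity ?G"
    using card_le_max_nullity[OF graph_hopi_rectangle hopi_corner_subset sum_hopi_null
        hopi_null_diag hopi_null_off_diag]
    by (simp add: card_hopi_corner)
  moreover have "max_nullity ?G \<le> zero_forcing_number ?G"
    by (rule max_nullity_le_zero_forcing_number[OF graph_hopi_rectangle])
  moreover have "zero_forcing_number ?G \<le> a + b"
    using zero_forcing_number_le[OF finite_verts_hopi_rectangle zero_forcing_set_hopi_corner]
    by (simp add: card_hopi_corner)
  ultimately show ?thesis by simp
qed

end
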